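(* Let $V$ be a finite-dimensional vector space, $\mathcal{X}=(X_1,\dots,X_n)$ a family of subspaces of $V$, and $M$ the $q$-matroid on $V$ whose independent subspaces are the partial $q$-transversals of $\mathcal{X}$. Then for each $1\le i\le n$, the subspace $X_i$ is a flat of $M$.
   Context: A $q$-matroid on $V$ is given by a rank function $r$ on subspaces with $0\le r(A)\le\dim A$, monotone and submodular; a subspace $A$ is independent if $r(A)=\dim A$. A partial $q$-transversal of $\mathcal{X}$ is a subspace $T$ such that every vector basis $B$ of $T$ admits an injection $\pi:B\to\{1,\dots,n\}$ with $b\notin X_{\pi(b)}$ for all $b\in B$ (these form the independent subspaces of a $q$-matroid). The closure of a subspace $A$ is the largest subspace $B$ with $A\le B\le V$ and $r(B)=r(A)$; $A$ is a flat if it equals its closure, equivalently $r(Y)>r(A)$ for every subspace $Y\ge A$ with $\dim Y=\dim A+1$. *)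

theory Defs
  imports Main "HOL.Vector_Spaces"
begin

context vector_space
begin

text \<open>The ground space \<open>V\<close> is the whole type \<open>'b\<close>. Rank functions are total on sets of vectors,
  but only their values on subspaces matter; \<open>span (A \<union> B)\<close> is the subspace sum \<open>A + B\<close>.\<close>

definition q_matroid :: "('b set \<Rightarrow> nat) \<Rightarrow> bool" where
  "q_matroid r \<longleftrightarrow>
     (\<forall>A. subspace A \<longrightarrow> r A \<le> dim A) \<and>
     (\<forall>A B. subspace A \<and> subspace B \<and> A \<subseteq> B \<longrightarrow> r A \<le> r B) \<and>
     (\<forall>A B. subspace A \<and> subspace B \<longrightarrow> r (span (A \<union> B)) + r (A \<inter> B) \<le> r A + r B)"

definition q_independent :: "('b set \<Rightarrow> nat) \<Rightarrow> 'b set \<Rightarrow> bool" where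
  "q_independent r A \<longleftrightarrow> subspace A \<and> r A = dim A"

definition partial_q_transversal :: "nat \<Rightarrow> (nat \<Rightarrow> 'b set) \<Rightarrow> 'b set \<Rightarrow> bool" where
  "partial_q_transversal n X T \<longleftrightarrow> subspace T \<and>
     (\<forall>B. independent B \<and> span B = T \<longrightarrow>
        (\<exists>\<pi>. inj_on \<pi> B \<and> \<pi> ` B \<subseteq> {1..n} \<and> (\<forall>b\<in>B. b \<notin> X (\<pi> b))))"

definition q_closure :: "('b set \<Rightarrow> nat) \<Rightarrow> 'b set \<Rightarrow> 'b set" where
  "q_closure r A = (GREATEST B. subspace B \<and> A \<subseteq> B \<and> r B = r A)"

definition q_flat :: "('b set \<Rightarrow> nat) \<Rightarrow> 'b set \<Rightarrow> bool" where
  "q_flat r A \<longleftrightarrow> subspace A \<and> q_closure r A = A"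

end

end

theory Submission
  imports Defs
begin

text \<open>Choose an independent \<open>I \<le> X\<^sub>i\<close> with \<open>r I = r X\<^sub>i\<close>. If \<open>x \<notin> X\<^sub>i\<close>, then \<open>J = I + \<langle>x\<rangle>\<close> is again
  a partial \<open>q\<close>-transversal, by Hall's theorem: for a linearly independent \<open>S \<subseteq> J\<close>, the space
  \<open>\<langle>S\<rangle> \<inter> I\<close> has dimension at least \<open>|S| - 1\<close>, so it escapes at least \<open>|S| - 1\<close> of the \<open>X\<^sub>j\<close>, none of
  which is \<open>X\<^sub>i\<close>; and unless \<open>S \<subseteq> I\<close>, \<open>S\<close> escapes \<open>X\<^sub>i\<close> too, because \<open>J \<inter> X\<^sub>i = I\<close>. Hence every
  subspace properly containing \<open>X\<^sub>i\<close> has rank at least \<open>r X\<^sub>i + 1\<close>.\<close>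

section \<open>Hall's marriage theorem for finite families\<close>

theorem Hall_marriage:
  assumes "finite A"
    and "\<And>a. a \<in> A \<Longrightarrow> finite (N a)"
    and "\<And>S. S \<subseteq> A \<Longrightarrow> card S \<le> card (\<Union>a\<in>S. N a)"
  shows "\<exists>\<pi>. inj_on \<pi> A \<and> (\<forall>a\<in>A. \<pi> a \<in> N a)"
  using assms
proof (induction "card A" arbitrary: A N rule: less_induct)
  case less
  note fin = less.prems(1) and finN = less.prems(2) and hall = less.prems(3)
  show ?case
  \<comment> \<open>The split is on a tight set \<open>S\<close>: nonempty, proper, with no more
    than \<open>card S\<close> neighbours. Such an \<open>S\<close> must use up all its neighbours,
    so \<open>S\<close> and \<open>A - S\<close> are matched separately.\<close>
  proof (cases "\<exists>S. S \<subset> A \<and> S \<noteq> {} \<and> card (\<Union>a\<in>S. N a) \<le> card S")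
    case True
    then obtain S where S: "S \<subset> A" "S \<noteq> {}" "card (\<Union>a\<in>S. N a) \<le> card S"
      by blast
    have finS: "finite S" using S(1) fin finite_subset by blast
    have "\<exists>\<pi>. inj_on \<pi> S \<and> (\<forall>a\<in>S. \<pi> a \<in> N a)"
    proof (rule less.hyps)
      show "card S < card A" using S(1) fin by (simp add: psubset_card_mono)
      show "finite S" by (fact finS)
      show "finite (N a)" if "a \<in> S" for a using finN S(1) that by blast
      show "card U \<le> card (\<Union>a\<in>U. N a)" if "U \<subseteq> S" for U using hall S(1) that by blast
    qed
    then obtain \<pi> where \<pi>: "inj_on \<pi> S" "\<forall>a\<in>S. \<pi> a \<in> N a" by blast
    let ?M = "\<Union>a\<in>S. N a"
    have "\<exists>\<rho>. inj_on \<rho> (A - S) \<and> (\<forall>a\<in>A - S. \<rho> a \<in> N a - ?M)"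
    proof (rule less.hyps)
      show "card (A - S) < card A" using S fin by (intro psubset_card_mono) auto
      show "finite (A - S)" using fin by simp
      show "finite (N a - ?M)" if "a \<in> A - S" for a using finN that by blast
      show "card U \<le> card (\<Union>a\<in>U. N a - ?M)" if U: "U \<subseteq> A - S" for U
      proof -
        have finU: "finite U" using U fin finite_subset by blast
        \<comment> \<open>Hall's condition survives the removal of \<open>?M\<close>: apply it to
          \<open>U \<union> S\<close> and subtract the tight set, whose neighbourhood
          \<open>?M\<close> accounts for at most \<open>card S\<close>.\<close>
        have "card U + card S = card (U \<union> S)"
          using U finU finS by (subst card_Un_disjoint) auto
        also have "\<dots> \<le> card (\<Union>a\<in>U \<union> S. N a)" using U S(1) by (intro hall) auto
        also have "(\<Union>a\<in>U \<union> S. N a) = (\<Union>a\<in>U. N a - ?M) \<union> ?M" by blast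
        also have "card \<dots> \<le> card (\<Union>a\<in>U. N a - ?M) + card ?M" by (rule card_Un_le)
        finally show ?thesis using S(3) by linarith
      qed
    qed
    then obtain \<rho> where \<rho>: "inj_on \<rho> (A - S)" "\<forall>a\<in>A - S. \<rho> a \<in> N a - ?M" by blast
    let ?\<sigma> = "\<lambda>a. if a \<in> S then \<pi> a else \<rho> a"
    have "inj_on ?\<sigma> A"
    proof -
      have "inj_on ?\<sigma> S" using \<pi>(1) by (simp add: inj_on_def)
      moreover have "inj_on ?\<sigma> (A - S)" using \<rho>(1) by (simp add: inj_on_def)
      moreover have "?\<sigma> ` S \<subseteq> ?M" using \<pi>(2) by auto
      moreover have "?\<sigma> ` (A - S) \<inter> ?M = {}" using \<rho>(2) by auto
      ultimately have "inj_on ?\<sigma> (S \<union> (A - S))" unfolding inj_on_Un by blast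
      then show ?thesis using S(1) by (simp add: Un_absorb1 less_imp_le)
    qed
    moreover have "\<forall>a\<in>A. ?\<sigma> a \<in> N a" using \<pi>(2) \<rho>(2) by auto
    ultimately show ?thesis by blast
  next
    case False
    then have slack: "card S < card (\<Union>a\<in>S. N a)" if "S \<subset> A" "S \<noteq> {}" for S
      using that by (meson leI)
    show ?thesis
    proof (cases "A = {}")
      case True
      then show ?thesis by simp
    next
      case False
      \<comment> \<open>Without a tight set, any \<open>a\<close> may take any neighbour
        \<open>y\<close>: deleting \<open>y\<close> costs the remaining sets at most one neighbour,
        which the strict inequality \<open>slack\<close> can spare.\<close>
      then obtain a where a: "a \<in> A" by blast
      have "card {a} \<le> card (N a)" using hall[of "{a}"] a by simp
      then obtain y where y: "y \<in> N a" by fastforce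
      have "\<exists>\<rho>. inj_on \<rho> (A - {a}) \<and> (\<forall>b\<in>A - {a}. \<rho> b \<in> N b - {y})"
      proof (rule less.hyps)
        show "card (A - {a}) < card A" using a fin by (intro card_Diff1_less)
        show "finite (A - {a})" using fin by simp
        show "finite (N b - {y})" if "b \<in> A - {a}" for b using finN that by blast
        show "card U \<le> card (\<Union>b\<in>U. N b - {y})" if U: "U \<subseteq> A - {a}" for U
        proof (cases "U = {}")
          case True
          then show ?thesis by simp
        next
          case False
          have "card U < card (\<Union>b\<in>U. N b)"
            using slack[of U] False U a by blast
          moreover have "(\<Union>b\<in>U. N b - {y}) = (\<Union>b\<in>U. N b) - {y}" by blast
          moreover have "card (\<Union>b\<in>U. N b) - 1 \<le> card ((\<Union>b\<in>U. N b) - {y})"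
            using diff_card_le_card_Diff[of "{y}" "\<Union>b\<in>U. N b"] by simp
          ultimately show ?thesis by simp
        qed
      qed
      then obtain \<rho> where \<rho>: "inj_on \<rho> (A - {a})" "\<forall>b\<in>A - {a}. \<rho> b \<in> N b - {y}" by blast
      have "inj_on (\<rho>(a := y)) A"
        using \<rho> unfolding inj_on_def by (auto simp: fun_upd_def)
      moreover have "\<forall>b\<in>A. (\<rho>(a := y)) b \<in> N b" using \<rho>(2) y by auto
      ultimately show ?thesis by blast
    qed
  qed
qed

context finite_dimensional_vector_space
begin

section \<open>Rank in a q-matroid\<close>

lemma q_matroid_rank_le_dim: "q_matroid r \<Longrightarrow> subspace A \<Longrightarrow> r A \<le> dim A"
  by (simp add: q_matroid_def)

lemma q_matroid_mono: "q_matroid r \<Longrightarrow> subspace A \<Longrightarrow> subspace B \<Longrightarrow> A \<subseteq> B \<Longrightarrow> r A \<le> r B"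
  by (simp add: q_matroid_def)

lemma q_matroid_submodular:
  "q_matroid r \<Longrightarrow> subspace A \<Longrightarrow> subspace B \<Longrightarrow> r (span (A \<union> B)) + r (A \<inter> B) \<le> r A + r B"
  by (simp add: q_matroid_def)

lemma dim_span_insert: "subspace A \<Longrightarrow> x \<notin> A \<Longrightarrow> dim (span (insert x A)) = dim A + 1"
  by (simp add: dim_insert span_eq_iff[THEN iffD2])

lemma q_independent_0: "q_matroid r \<Longrightarrow> q_independent r {0}"
  using q_matroid_rank_le_dim[of r "{0}"] by (simp add: q_independent_def subspace_single_0)

lemma q_matroid_rank_span_insert_le:
  assumes "q_matroid r" "subspace A"
  shows "r (span (insert x A)) \<le> r A + 1"
proof -
  have "r (span (A \<union> span {x})) + r (A \<inter> span {x}) \<le> r A + r (span {x})"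
    by (intro q_matroid_submodular assms subspace_span)
  moreover have "r (span (insert x A)) \<le> r (span (A \<union> span {x}))"
    by (intro q_matroid_mono assms subspace_span span_mono) (auto intro: span_base)
  moreover have "r (span {x}) \<le> 1"
    using q_matroid_rank_le_dim[OF assms(1) subspace_span, of "{x}"] dim_le_card'[of "{x}"] by simp
  ultimately show ?thesis by simp
qed

text \<open>An independent \<open>I\<close> of maximal dimension inside \<open>A\<close> works: no
  single vector of \<open>A\<close> raises its rank, and submodularity passes this on from single
  vectors to all of \<open>A\<close>.\<close>

lemma q_matroid_basis_exists:
  assumes r: "q_matroid r" and A: "subspace A"
  obtains I where "q_independent r I" "I \<subseteq> A" "r I = r A"
proof -
  define P where "P I \<longleftrightarrow> q_independent r I \<and> I \<subseteq> A" for I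
  have "P {0}" using q_independent_0[OF r] subspace_0[OF A] by (simp add: P_def)
  moreover have "\<forall>I. P I \<longrightarrow> dim I < dimension + 1"
    using dim_subset_UNIV by (simp add: less_Suc_eq_le)
  ultimately obtain I where I: "P I" "\<And>K. P K \<Longrightarrow> dim K \<le> dim I"
    using ex_has_greatest_nat[of P "{0}" dim "dimension + 1"] by blast
  then have sI: "subspace I" and rI: "r I = dim I" and IA: "I \<subseteq> A"
    by (auto simp: P_def q_independent_def)
  \<comment> \<open>One vector adds at most 1 to the rank. If it added exactly 1, the enlarged
    subspace would be independent, against the maximality of \<open>I\<close>.\<close>
  have step: "r (span (insert x I)) = r I" if x: "x \<in> A" for x
  proof (rule antisym)
    show "r I \<le> r (span (insert x I))"
      by (intro q_matroid_mono[OF r] sI subspace_span) (auto intro: span_base)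
    show "r (span (insert x I)) \<le> r I"
    proof (rule ccontr)
      assume "\<not> r (span (insert x I)) \<le> r I"
      then have *: "r (span (insert x I)) = r I + 1"
        using q_matroid_rank_span_insert_le[OF r sI, of x] by linarith
      then have "x \<notin> I" by (auto simp: insert_absorb span_eq_iff[THEN iffD2, OF sI])
      then have "dim (span (insert x I)) = dim I + 1" by (rule dim_span_insert[OF sI])
      moreover from this have "P (span (insert x I))"
        using * rI x IA A by (simp add: P_def q_independent_def span_minimal)
      ultimately show False using I(2) by fastforce
    qed
  qed
  \<comment> \<open>A largest \<open>K\<close> between \<open>I\<close> and \<open>A\<close> that
    still has the rank of \<open>I\<close>; it will turn out to be \<open>A\<close>.\<close>
  define Q where "Q K \<longleftrightarrow> subspace K \<and> I \<subseteq> K \<and> K \<subseteq> A \<and> r K = r I" for K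
  have "Q I" using sI IA by (simp add: Q_def)
  moreover have "\<forall>K. Q K \<longrightarrow> dim K < dimension + 1"
    using dim_subset_UNIV by (simp add: less_Suc_eq_le)
  ultimately obtain K where K: "Q K" "\<And>L. Q L \<Longrightarrow> dim L \<le> dim K"
    using ex_has_greatest_nat[of Q I dim "dimension + 1"] by blast
  then have sK: "subspace K" and IK: "I \<subseteq> K" and KA: "K \<subseteq> A" and rK: "r K = r I"
    by (auto simp: Q_def)
  have "A \<subseteq> K"
  proof (rule subsetI, rule ccontr)
    fix x assume x: "x \<in> A" "x \<notin> K"
    let ?L = "span (insert x K)"
    \<comment> \<open>Both subspaces have rank \<open>r I\<close> and their intersection contains
      \<open>I\<close>, so their sum, and with it \<open>?L\<close>, has rank at most
      \<open>r I\<close>.\<close>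
    have "r (span (K \<union> span (insert x I))) + r (K \<inter> span (insert x I)) \<le> r K + r (span (insert x I))"
      by (intro q_matroid_submodular r sK subspace_span)
    moreover have "r I \<le> r (K \<inter> span (insert x I))"
      using IK by (intro q_matroid_mono[OF r] sI subspace_inter sK subspace_span)
        (auto intro: span_base)
    moreover have "r ?L \<le> r (span (K \<union> span (insert x I)))"
    proof (intro q_matroid_mono[OF r] subspace_span span_minimal)
      show "insert x K \<subseteq> span (K \<union> span (insert x I))"
        by (auto intro: span_base)
    qed
    moreover have "r I \<le> r ?L"
      using IK by (intro q_matroid_mono[OF r] sI subspace_span) (auto intro: span_base)
    ultimately have "r ?L = r I" using step[OF x(1)] rK by linarith
    then have "Q ?L"
      using IK KA x A by (auto simp: Q_def span_minimal intro: span_base)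
    then show False using K(2)[of ?L] dim_span_insert[OF sK x(2)] by simp
  qed
  with KA rK have "r I = r A" by simp
  then show ?thesis using that I(1) by (auto simp: P_def)
qed

section \<open>Partial q-transversals through Hall's condition\<close>

lemma partial_q_transversal_card_le:
  assumes T: "partial_q_transversal n X T" and S: "independent S" "S \<subseteq> T"
  shows "card S \<le> card {j \<in> {1..n}. \<not> S \<subseteq> X j}"
proof -
  \<comment> \<open>The definition speaks only of bases of the whole of \<open>T\<close>, so
    \<open>S\<close> is first extended to one and the injection is then restricted.\<close>
  obtain B where B: "S \<subseteq> B" "B \<subseteq> T" "independent B" "T \<subseteq> span B"
    using maximal_independent_subset_extend[OF S(2,1)] by blast
  then have "span B = T"
    using T by (auto simp: partial_q_transversal_def dest: span_minimal)
  then obtain \<pi> where \<pi>: "inj_on \<pi> B" "\<pi> ` B \<subseteq> {1..n}" "\<forall>b\<in>B. b \<notin> X (\<pi> b)"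
    using T B(3) unfolding partial_q_transversal_def by blast
  show ?thesis
  proof (rule card_inj_on_le)
    show "inj_on \<pi> S" using \<pi>(1) B(1) by (rule inj_on_subset)
    show "\<pi> ` S \<subseteq> {j \<in> {1..n}. \<not> S \<subseteq> X j}" using \<pi> B(1) by blast
  qed simp
qed

text \<open>For a basis vector \<open>b\<close> let the admissible indices be those \<open>j\<close>
  with \<open>b \<notin> X j\<close>. The indices admissible for some member of \<open>S\<close> are
  then those with \<open>\<not> S \<subseteq> X j\<close>, so the assumption is Hall's condition for
  every basis at once.\<close>

lemma partial_q_transversalI:
  assumes "subspace T"
    and "\<And>S. independent S \<Longrightarrow> S \<subseteq> T \<Longrightarrow> card S \<le> card {j \<in> {1..n}. \<not> S \<subseteq> X j}"
  shows "partial_q_transversal n X T"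
  unfolding partial_q_transversal_def
proof (intro conjI allI impI)
  fix B assume B: "independent B \<and> span B = T"
  have "\<exists>\<pi>. inj_on \<pi> B \<and> (\<forall>b\<in>B. \<pi> b \<in> {j \<in> {1..n}. b \<notin> X j})"
  proof (rule Hall_marriage)
    show "finite B" using B finiteI_independent by blast
    fix S assume S: "S \<subseteq> B"
    then have "card S \<le> card {j \<in> {1..n}. \<not> S \<subseteq> X j}"
      using B independent_mono[of B S] by (intro assms(2)) (auto intro: span_base)
    also have "{j \<in> {1..n}. \<not> S \<subseteq> X j} = (\<Union>b\<in>S. {j \<in> {1..n}. b \<notin> X j})" by blast
    finally show "card S \<le> card (\<Union>b\<in>S. {j \<in> {1..n}. b \<notin> X j})" .
  qed simp
  then show "\<exists>\<pi>. inj_on \<pi> B \<and> \<pi> ` B \<subseteq> {1..n} \<and> (\<forall>b\<in>B. b \<notin> X (\<pi> b))" by blast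
qed (fact assms(1))

lemma partial_q_transversal_span_insert:
  assumes X: "\<And>j. j \<in> {1..n} \<Longrightarrow> subspace (X j)" and i: "i \<in> {1..n}"
    and I: "partial_q_transversal n X I" "I \<subseteq> X i" and x: "x \<notin> X i"
  shows "partial_q_transversal n X (span (insert x I))"
proof (rule partial_q_transversalI)
  have sI: "subspace I" using I(1) by (simp add: partial_q_transversal_def)
  let ?J = "span (insert x I)"
  have J_Int: "y \<in> I" if y: "y \<in> ?J" "y \<in> X i" for y
  proof -
    obtain k where k: "y - scale k x \<in> I"
      using y(1) sI by (auto simp: span_insert span_eq_iff[THEN iffD2])
    then have "scale k x \<in> X i"
      using subspace_diff[OF X[OF i] y(2), of "y - scale k x"] I(2) by auto
    \<comment> \<open>A nonzero \<open>k\<close> could be divided out, putting \<open>x\<close> into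
      \<open>X i\<close>.\<close>
    then have "k = 0"
      using x subspace_scale[OF X[OF i], of "scale k x" "inverse k"] by (cases "k = 0") auto
    then show ?thesis using k by simp
  qed
  fix S assume S: "independent S" "S \<subseteq> ?J"
  show "card S \<le> card {j \<in> {1..n}. \<not> S \<subseteq> X j}"
  proof (cases "S \<subseteq> I")
    case True
    then show ?thesis using partial_q_transversal_card_le[OF I(1) S(1)] by simp
  next
    case False
    then have Si: "\<not> S \<subseteq> X i" using J_Int S(2) by blast
    obtain C where C: "C \<subseteq> span S \<inter> I" "independent C" "card C = dim (span S \<inter> I)"
      using basis_exists[of "span S \<inter> I"] by metis
    \<comment> \<open>The sum of \<open>span S\<close> and \<open>I\<close> lies in
      \<open>?J\<close>, which is only one dimension larger than \<open>I\<close>; by the dimension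
      formula \<open>span S \<inter> I\<close> loses at most one dimension against
      \<open>span S\<close>.\<close>
    have "{a + b |a b. a \<in> span S \<and> b \<in> I} \<subseteq> ?J"
      using span_minimal[OF S(2)] by (auto intro!: span_add intro: span_base)
    then have "dim {a + b |a b. a \<in> span S \<and> b \<in> I} \<le> dim ?J" by (rule dim_subset)
    also have "dim ?J = dim I + 1" using I(2) x by (intro dim_span_insert sI) blast
    finally have "dim {a + b |a b. a \<in> span S \<and> b \<in> I} \<le> dim I + 1" .
    moreover have "dim (span S) = card S" using S(1) by (simp add: dim_eq_card_independent)
    ultimately have "card S \<le> card C + 1"
      using dim_sums_Int[OF subspace_span[of S] sI] C(3) by linarith
    also have "card C \<le> card {j \<in> {1..n}. \<not> C \<subseteq> X j}"
      using partial_q_transversal_card_le[OF I(1) C(2)] C(1) by blast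
    \<comment> \<open>The index \<open>i\<close> is new, since
      \<open>C \<subseteq> I \<subseteq> X i\<close>.\<close>
    also have "\<dots> + 1 = card (insert i {j \<in> {1..n}. \<not> C \<subseteq> X j})"
      using C(1) I(2) by (subst card_insert_disjoint) auto
    also have "\<dots> \<le> card {j \<in> {1..n}. \<not> S \<subseteq> X j}"
    proof (rule card_mono)
      \<comment> \<open>A subspace \<open>X j\<close> containing \<open>S\<close> contains
        \<open>span S\<close> and hence \<open>C\<close>; so an index escaped by \<open>C\<close> is
        escaped by \<open>S\<close>.\<close>
      show "insert i {j \<in> {1..n}. \<not> C \<subseteq> X j} \<subseteq> {j \<in> {1..n}. \<not> S \<subseteq> X j}"
        using i Si C(1) span_minimal[OF _ X] by blast
    qed simp
    finally show ?thesis by simp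
  qed
qed (rule subspace_span)

text \<open>The assumption makes \<open>A\<close> itself the greatest element under inclusion, so
  \<open>GREATEST\<close> can be evaluated at \<open>A\<close> without showing that closures exist
  in general.\<close>

lemma q_flatI:
  assumes "subspace A"
    and "\<And>B. subspace B \<Longrightarrow> A \<subseteq> B \<Longrightarrow> r B = r A \<Longrightarrow> B \<subseteq> A"
  shows "q_flat r A"
proof -
  have "(GREATEST B. subspace B \<and> A \<subseteq> B \<and> r B = r A) = A"
    by (rule Greatest_equality) (use assms in auto)
  then show ?thesis using assms(1) by (simp add: q_flat_def q_closure_def)
qed

end

theorem theorem22:
  fixes scale :: "'a::field \<Rightarrow> 'b::ab_group_add \<Rightarrow> 'b"
    and Basis :: "'b set"
    and n :: nat
    and X :: "nat \<Rightarrow> 'b set"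
    and r :: "'b set \<Rightarrow> nat"
  assumes "finite_dimensional_vector_space scale Basis"
    and "\<And>i. i \<in> {1..n} \<Longrightarrow> module.subspace scale (X i)"
    and "vector_space.q_matroid scale r"
    and "\<And>T. module.subspace scale T \<Longrightarrow>
           vector_space.q_independent scale r T \<longleftrightarrow> vector_space.partial_q_transversal scale n X T"
  shows "\<forall>i\<in>{1..n}. vector_space.q_flat scale r (X i)"
proof
  interpret finite_dimensional_vector_space scale Basis by (fact assms(1))
  note X = assms(2) and r = assms(3) and indep = assms(4)
  fix i assume i: "i \<in> {1..n}"
  \<comment> \<open>\<open>X i\<close> itself may be dependent, so the vector \<open>x\<close> is
    added to an independent subspace of the same rank.\<close>
  obtain I where I: "q_independent r I" "I \<subseteq> X i" "r I = r (X i)"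
    using q_matroid_basis_exists[OF r X[OF i]] .
  then have sI: "subspace I" and dI: "r I = dim I" by (auto simp: q_independent_def)
  have tI: "partial_q_transversal n X I" using indep[OF sI] I(1) by blast
  show "q_flat r (X i)"
  proof (rule q_flatI[OF X[OF i]], rule subsetI, rule ccontr)
    fix B x assume B: "subspace B" "X i \<subseteq> B" "r B = r (X i)" and x: "x \<in> B" "x \<notin> X i"
    let ?J = "span (insert x I)"
    have "q_independent r ?J"
      using partial_q_transversal_span_insert[OF X i tI I(2) x(2)] indep[OF subspace_span] by blast
    then have "r ?J = r I + 1"
      using dim_span_insert[OF sI, of x] dI I(2) x(2) by (auto simp: q_independent_def)
    \<comment> \<open>\<open>B\<close> contains both \<open>x\<close> and \<open>I\<close>, hence
      \<open>?J\<close>, whose rank exceeds that of \<open>X i\<close> by one.\<close>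
    moreover have "r ?J \<le> r B"
      using I(2) B x(1) by (intro q_matroid_mono[OF r] subspace_span span_minimal) auto
    ultimately show False using B(3) I(3) by simp
  qed
qed

end
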